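(* Let $\widehat K=[-1,1]^2$. For an integer $p\ge1$ let $\mathcal{Q}^{p-1}(\widehat K)=\mathrm{span}\{x^iy^j: 0\le i,j\le p-1\}$, and let $b_{\mathrm i}(x,y)=(1+x)(1+y)$ and $b_{\mathrm o}(x,y)=(1-x)(1-y)$. For $k\in\mathbb{R}\setminus\{0\}$ consider the problem: find $u_r\in\mathcal{Q}^{p-1}(\widehat K)$ such that $$(\nabla(b_{\mathrm i}u_r),\nabla(b_{\mathrm o}v_r))_{\widehat K}-k^2(b_{\mathrm i}u_r,b_{\mathrm o}v_r)_{\widehat K}=0\qquad\forall v_r\in\mathcal{Q}^{p-1}(\widehat K).\qquad( * )$$ For $p=1,2,3$ the only solution of $( * )$ is the trivial solution $u_r\equiv0$, for every $k\in\mathbb{R}\setminus\{0\}$. For $p=4$ and some $k>0$ there exists a non-trivial solution of $( * )$.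
   Context: $(\cdot,\cdot)_{\widehat K}$ denotes the $L^2(\widehat K)$ scalar product $(u,v)_{\widehat K}=\int_{\widehat K}u\overline v$ (applied componentwise and summed for gradients); functions are complex-valued and spans are over $\mathbb{C}$. *)

theory Defs
  imports "HOL-Analysis.Analysis" "HOL-Library.Function_Algebras"
begin

definition cscale :: "complex \<Rightarrow> (real \<times> real \<Rightarrow> complex) \<Rightarrow> (real \<times> real \<Rightarrow> complex)"
  where "cscale c f = (\<lambda>z. c * f z)"

global_interpretation cfun: vector_space cscale
  by unfold_locales (auto simp: cscale_def fun_eq_iff algebra_simps)

definition Khat :: "(real \<times> real) set"
  where "Khat = {-1..1} \<times> {-1..1}"

(* Elements are polynomial functions on the whole plane; Khat has non-empty
   interior, so each of them is determined by its restriction to Khat. *)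
definition Qpoly :: "nat \<Rightarrow> (real \<times> real \<Rightarrow> complex) set"
  where "Qpoly m = cfun.span {(\<lambda>(x, y). of_real (x ^ i * y ^ j)) | i j. i \<le> m \<and> j \<le> m}"

definition L2_ip :: "(real \<times> real \<Rightarrow> complex) \<Rightarrow> (real \<times> real \<Rightarrow> complex) \<Rightarrow> complex"
  where "L2_ip u v = (LINT z:Khat|lborel. u z * cnj (v z))"

definition partial_x :: "(real \<times> real \<Rightarrow> complex) \<Rightarrow> (real \<times> real \<Rightarrow> complex)"
  where "partial_x f = (\<lambda>(x, y). vector_derivative (\<lambda>t. f (t, y)) (at x))"

definition partial_y :: "(real \<times> real \<Rightarrow> complex) \<Rightarrow> (real \<times> real \<Rightarrow> complex)"
  where "partial_y f = (\<lambda>(x, y). vector_derivative (\<lambda>t. f (x, t)) (at y))"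

definition grad_ip :: "(real \<times> real \<Rightarrow> complex) \<Rightarrow> (real \<times> real \<Rightarrow> complex) \<Rightarrow> complex"
  where "grad_ip f g = L2_ip (partial_x f) (partial_x g) + L2_ip (partial_y f) (partial_y g)"

definition b_in :: "real \<times> real \<Rightarrow> complex"
  where "b_in = (\<lambda>(x, y). of_real ((1 + x) * (1 + y)))"

definition b_out :: "real \<times> real \<Rightarrow> complex"
  where "b_out = (\<lambda>(x, y). of_real ((1 - x) * (1 - y)))"

definition solves_problem :: "nat \<Rightarrow> real \<Rightarrow> (real \<times> real \<Rightarrow> complex) \<Rightarrow> bool"
  where "solves_problem p k u \<longleftrightarrow>
    u \<in> Qpoly (p - 1) \<and>
    (\<forall>v \<in> Qpoly (p - 1).
      grad_ip (\<lambda>z. b_in z * u z) (\<lambda>z. b_out z * v z)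
        - of_real (k ^ 2) * L2_ip (\<lambda>z. b_in z * u z) (\<lambda>z. b_out z * v z) = 0)"

end

theory Submission
  imports Defs "HOL-Computational_Algebra.Polynomial"
begin

text \<open>
  Write \<open>a\<^sub>k(u, v)\<close> for the form on the left-hand side of the problem.  Both weights are
  products of univariate ones, so on products \<open>f(x) r(y)\<close> and \<open>g(x) q(y)\<close> of real polynomials
  \<open>a\<^sub>k\<close> equals \<open>K(f, g) M(r, q) + M(f, g) K(r, q) - k\<^sup>2 M(f, g) M(r, q)\<close> with the
  univariate pairings \<open>M(f, g) = \<integral> (1 + x) f (1 - x) g\<close> and
  \<open>K(f, g) = \<integral> ((1 + x) f)' ((1 - x) g)'\<close> over \<open>[-1, 1]\<close> (\<open>mass\<close>, \<open>stiff\<close>, lemma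
  \<open>weak_form_tensor_sum\<close>).  The pairing \<open>M\<close> is an inner product; let \<open>B\<close> be the operator on
  polynomials of degree below \<open>p\<close> with \<open>K(f, g) = M(B f, g)\<close>.  A nontrivial solution exists exactly if
  \<open>k\<^sup>2\<close> is an eigenvalue of \<open>B \<otimes> 1 + 1 \<otimes> B\<close>, that is, a sum of two eigenvalues of \<open>B\<close>.

  For \<open>p \<le> 3\<close> all eigenvalues of \<open>B\<close> lie in the open left half-plane, so no such sum is
  positive.  A certificate for this is a basis \<open>f\<close> of the polynomials, with a second family \<open>g\<close>
  of test polynomials, such that \<open>M(f i, g j)\<close> is a positive diagonal matrix and
  \<open>K(f i, g j)\<close> is a skew-symmetric matrix plus a nonpositive diagonal one.  Testing
  \<open>u = \<Sum> c i j (f i \<otimes> f j)\<close> with \<open>\<Sum> c i j (g i \<otimes> g j)\<close> and taking real parts, the terms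
  with \<open>K\<close> contribute at most \<open>0\<close> and the other one is \<open>-k\<^sup>2\<close> times a positive definite form in
  \<open>c\<close>, whence \<open>c = 0\<close> (lemma \<open>trivial_if_biorthogonal_skew\<close>).  Monomials serve for
  \<open>p \<le> 2\<close>.  For \<open>p = 3\<close> the basis is one in which \<open>B\<close> is tridiagonal with a single nonzero
  diagonal entry (the Schwarz form behind the Routh-Hurwitz criterion).

  For \<open>p = 4\<close> the characteristic polynomial of \<open>B\<close> is
  \<open>t\<^sup>4 + 12 t\<^sup>3 + 189 t\<^sup>2 + 2520 t + 19845\<close>.  It violates the Routh-Hurwitz condition
  \<open>12 \<cdot> 189 > 2520\<close>, and indeed two of its roots have a sum \<open>s > 0\<close>
  (lemma \<open>quartic4_roots_positive_sum\<close>).  The product of the two corresponding eigenvectors, one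
  in \<open>x\<close> and the other in \<open>y\<close>, solves the problem with \<open>k\<^sup>2 = s\<close>.
\<close>

section \<open>Weighted moments of univariate polynomials\<close>

definition sym_integral :: "real poly \<Rightarrow> real"
  where "sym_integral p = integral {-1..1} (poly p)"

definition mass :: "real poly \<Rightarrow> real poly \<Rightarrow> real"
  where "mass f g = sym_integral (([:1, 1:] * f) * ([:1, -1:] * g))"

definition stiff :: "real poly \<Rightarrow> real poly \<Rightarrow> real"
  where "stiff f g = sym_integral (pderiv ([:1, 1:] * f) * pderiv ([:1, -1:] * g))"

text \<open>
  The shift \<open>n\<close> in the exponent is what makes the integral recursive in the coefficient list, so
  that rewriting evaluates the pairings of explicit polynomials.
\<close>

definition moment :: "nat \<Rightarrow> real poly \<Rightarrow> real"
  where "moment n p = integral {-1..1} (\<lambda>x. x ^ n * poly p x)"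

lemma sym_integral_eq_moment: "sym_integral p = moment 0 p"
  by (simp add: sym_integral_def moment_def)

lemma moment_0 [simp]: "moment n 0 = 0"
  by (simp add: moment_def)

lemma has_integral_power_sym:
  "((\<lambda>x::real. x ^ n) has_integral (1 - (-1) ^ Suc n) / real (Suc n)) {-1..1}"
proof -
  have "((\<lambda>x::real. x ^ n) has_integral (1 ^ Suc n / real (Suc n) - (-1) ^ Suc n / real (Suc n))) {-1..1}"
  proof (rule fundamental_theorem_of_calculus)
    fix x :: real
    have "((\<lambda>x. x ^ Suc n / real (Suc n)) has_real_derivative x ^ n) (at x within {-1..1})"
      by (rule derivative_eq_intros refl | simp)+
    then show "((\<lambda>x. x ^ Suc n / real (Suc n)) has_vector_derivative x ^ n) (at x within {-1..1})"
      by (simp add: has_real_derivative_iff_has_vector_derivative)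
  qed simp
  then show ?thesis by (simp add: add_divide_distrib)
qed

lemma moment_pCons:
  "moment n (pCons a p) = a * ((1 - (-1) ^ Suc n) / real (Suc n)) + moment (Suc n) p"
proof -
  have "((\<lambda>x. x ^ Suc n * poly p x) has_integral moment (Suc n) p) {-1..1}"
    unfolding moment_def
    by (intro integrable_integral integrable_continuous_real continuous_intros)
  from has_integral_add[OF has_integral_mult_right[OF has_integral_power_sym, of a n] this]
  have "((\<lambda>x. x ^ n * poly (pCons a p) x) has_integral
      (a * ((1 - (-1) ^ Suc n) / real (Suc n)) + moment (Suc n) p)) {-1..1}"
    by (simp add: algebra_simps)
  then show ?thesis by (simp add: moment_def integral_unique)
qed

lemma less_3_cases: "(i::nat) < 3 \<longleftrightarrow> i = 0 \<or> i = 1 \<or> i = 2" by auto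

lemma less_4_cases: "(i::nat) < 4 \<longleftrightarrow> i = 0 \<or> i = 1 \<or> i = 2 \<or> i = 3" by auto

lemma monom_2: "monom 1 2 = [:0, 0, 1::real:]"
  by (simp add: monom_0 monom_Suc numeral_2_eq_2)

lemma monom_3: "monom 1 3 = [:0, 0, 0, 1::real:]"
  by (simp add: monom_0 monom_Suc numeral_3_eq_3)

lemma monom_eq_sum_monom:
  "i < p \<Longrightarrow> monom (1::real) i = (\<Sum>l<p. smult (if l = i then 1 else 0) (monom 1 l))"
  by (simp add: if_distrib[of "\<lambda>a. smult a _"] cong: if_cong)

lemmas pairing_simps = mass_def stiff_def sym_integral_eq_moment moment_pCons pderiv_pCons

section \<open>The bilinear form on tensor products\<close>

definition tensor_sum ::
    "nat \<Rightarrow> (nat \<Rightarrow> nat \<Rightarrow> complex) \<Rightarrow> (nat \<Rightarrow> real poly) \<Rightarrow> (nat \<Rightarrow> real poly) \<Rightarrow> real \<times> real \<Rightarrow> complex"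
  where "tensor_sum n c f g =
    (\<lambda>(x, y). \<Sum>i<n. \<Sum>j<n. c i j * of_real (poly (f i) x * poly (g j) y))"

lemma set_integrable_continuous_Khat:
  fixes F :: "real \<times> real \<Rightarrow> complex"
  assumes "continuous_on UNIV F"
  shows "set_integrable lborel Khat F"
proof -
  have "compact Khat" unfolding Khat_def by (intro compact_Times compact_Icc)
  then show ?thesis
    unfolding set_integrable_def
    by (intro borel_integrable_compact continuous_on_subset[OF assms]) auto
qed

lemma integral_Khat_product:
  "(LINT z:Khat|lborel. of_real (poly p (fst z) * poly q (snd z)) :: complex)
     = of_real (sym_integral p * sym_integral q)"
proof -
  let ?I = "\<lambda>x::real. indicator {-1..1} x :: real"
  let ?F = "\<lambda>z. ?I (fst z) * poly p (fst z) * (?I (snd z) * poly q (snd z))"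
  have one: "(LINT x|lborel. ?I x * poly r x) = sym_integral r" for r
  proof -
    have "set_integrable lborel {-1..1} (poly r)"
      unfolding set_integrable_def
      by (intro borel_integrable_compact continuous_intros) auto
    from set_borel_integral_eq_integral(2)[OF this] show ?thesis
      by (simp add: sym_integral_def set_lebesgue_integral_def)
  qed
  have ind: "indicator Khat z = ?I (fst z) * ?I (snd z)" for z
    by (cases z) (simp add: Khat_def indicator_times)
  have "set_integrable lborel Khat (\<lambda>z. complex_of_real (poly p (fst z) * poly q (snd z)))"
    by (intro set_integrable_continuous_Khat continuous_intros)
  then have "integrable lborel (\<lambda>z. complex_of_real (?F z))"
    unfolding set_integrable_def ind by (simp add: scaleR_conv_of_real mult_ac)
  then have int: "integrable (lborel \<Otimes>\<^sub>M lborel) ?F"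
    by (simp only: lborel_prod complex_of_real_integrable_eq)
  have "(LINT z:Khat|lborel. complex_of_real (poly p (fst z) * poly q (snd z)))
      = (LINT z|lborel. complex_of_real (?F z))"
    unfolding set_lebesgue_integral_def ind
    by (rule Bochner_Integration.integral_cong) (simp_all add: scaleR_conv_of_real mult_ac)
  also have "\<dots> = of_real (LINT z|(lborel \<Otimes>\<^sub>M lborel). ?F z)"
    by (simp add: lborel_prod del: of_real_mult)
  also have "(LINT z|(lborel \<Otimes>\<^sub>M lborel). ?F z) = (LINT x|lborel. LINT y|lborel. ?F (x, y))"
    using lborel_pair.integral_fst'[OF int] by simp
  also have "\<dots> = (LINT x|lborel. ?I x * poly p x * sym_integral q)"
    by (simp add: one)
  also have "\<dots> = sym_integral p * sym_integral q"
    by (simp add: one)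
  finally show ?thesis .
qed

lemma set_integrable_sum_finite:
  fixes F :: "'b \<Rightarrow> 'a \<Rightarrow> 'c::{banach, second_countable_topology}"
  assumes "\<And>i. i \<in> I \<Longrightarrow> set_integrable M A (F i)"
  shows "set_integrable M A (\<lambda>z. \<Sum>i\<in>I. F i z)"
  using assms unfolding set_integrable_def scaleR_sum_right
  by (intro Bochner_Integration.integrable_sum)

lemma set_integral_sum_finite:
  fixes F :: "'b \<Rightarrow> 'a \<Rightarrow> 'c::{banach, second_countable_topology}"
  assumes "\<And>i. i \<in> I \<Longrightarrow> set_integrable M A (F i)"
  shows "(LINT z:A|M. \<Sum>i\<in>I. F i z) = (\<Sum>i\<in>I. LINT z:A|M. F i z)"
  using assms unfolding set_integrable_def set_lebesgue_integral_def scaleR_sum_right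
  by (intro Bochner_Integration.integral_sum)

lemma L2_ip_tensor_sum:
  "L2_ip (tensor_sum n c f g) (tensor_sum n d h l) =
     (\<Sum>i<n. \<Sum>j<n. \<Sum>a<n. \<Sum>b<n. c i j * cnj (d a b)
        * of_real (sym_integral (f i * h a) * sym_integral (g j * l b)))"
proof -
  let ?T = "\<lambda>i j a b z. c i j * cnj (d a b)
      * complex_of_real (poly (f i * h a) (fst z) * poly (g j * l b) (snd z))"
  have prod: "tensor_sum n c f g z * cnj (tensor_sum n d h l z)
      = (\<Sum>i<n. \<Sum>j<n. \<Sum>a<n. \<Sum>b<n. ?T i j a b z)" for z
  proof -
    have "tensor_sum n c f g z * cnj (tensor_sum n d h l z) =
      (\<Sum>i<n. \<Sum>j<n. \<Sum>a<n. \<Sum>b<n.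
        (c i j * of_real (poly (f i) (fst z) * poly (g j) (snd z)))
          * cnj (d a b * of_real (poly (h a) (fst z) * poly (l b) (snd z))))"
      unfolding tensor_sum_def case_prod_beta cnj_sum sum_distrib_right
      unfolding sum_distrib_left ..
    then show ?thesis by (simp add: mult_ac)
  qed
  have int: "set_integrable lborel Khat (?T i j a b)" for i j a b
    by (intro set_integrable_continuous_Khat continuous_intros)
  show ?thesis
    unfolding L2_ip_def prod
    by (simp only: set_integral_sum_finite finite_lessThan set_integrable_sum_finite int
        set_integral_mult_right integral_Khat_product)
qed


lemma partial_x_tensor_sum:
  "partial_x (tensor_sum n c f g) = tensor_sum n c (\<lambda>i. pderiv (f i)) g"
proof -
  have "((\<lambda>t. \<Sum>i<n. \<Sum>j<n. c i j * of_real (poly (f i) t * poly (g j) y)) has_vector_derivative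
      (\<Sum>i<n. \<Sum>j<n. c i j * of_real (poly (pderiv (f i)) x * poly (g j) y))) (at x)" for x y
    by (intro has_vector_derivative_sum has_vector_derivative_mult_right
        has_vector_derivative_of_real)
      (auto intro!: derivative_eq_intros poly_DERIV)
  then show ?thesis
    by (simp add: partial_x_def tensor_sum_def vector_derivative_at fun_eq_iff)
qed

lemma partial_y_tensor_sum:
  "partial_y (tensor_sum n c f g) = tensor_sum n c f (\<lambda>j. pderiv (g j))"
proof -
  have "((\<lambda>t. \<Sum>i<n. \<Sum>j<n. c i j * of_real (poly (f i) x * poly (g j) t)) has_vector_derivative
      (\<Sum>i<n. \<Sum>j<n. c i j * of_real (poly (f i) x * poly (pderiv (g j)) y))) (at y)" for x y
    by (intro has_vector_derivative_sum has_vector_derivative_mult_right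
        has_vector_derivative_of_real)
      (auto intro!: derivative_eq_intros poly_DERIV)
  then show ?thesis
    by (simp add: partial_y_def tensor_sum_def vector_derivative_at fun_eq_iff)
qed

lemma b_in_tensor_sum:
  "(\<lambda>z. b_in z * tensor_sum n c f g z)
     = tensor_sum n c (\<lambda>i. [:1, 1:] * f i) (\<lambda>j. [:1, 1:] * g j)"
  by (auto simp: fun_eq_iff b_in_def tensor_sum_def sum_distrib_left algebra_simps
      intro!: sum.cong)

lemma b_out_tensor_sum:
  "(\<lambda>z. b_out z * tensor_sum n c f g z)
     = tensor_sum n c (\<lambda>i. [:1, -1:] * f i) (\<lambda>j. [:1, -1:] * g j)"
  by (auto simp: fun_eq_iff b_out_def tensor_sum_def sum_distrib_left algebra_simps
      intro!: sum.cong)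

text \<open>
  Fubini's theorem splits every integral over the square.  No conjugate falls on the basis
  polynomials because they are real.
\<close>

lemma weak_form_tensor_sum:
  "grad_ip (\<lambda>z. b_in z * tensor_sum n c f f z) (\<lambda>z. b_out z * tensor_sum n d g g z)
     - of_real (k ^ 2) * L2_ip (\<lambda>z. b_in z * tensor_sum n c f f z) (\<lambda>z. b_out z * tensor_sum n d g g z)
   = (\<Sum>i<n. \<Sum>j<n. \<Sum>a<n. \<Sum>b<n. c i j * cnj (d a b) * of_real
        (stiff (f i) (g a) * mass (f j) (g b) + mass (f i) (g a) * stiff (f j) (g b)
          - k ^ 2 * (mass (f i) (g a) * mass (f j) (g b))))"
  unfolding grad_ip_def b_in_tensor_sum b_out_tensor_sum partial_x_tensor_sum
    partial_y_tensor_sum L2_ip_tensor_sum sum_distrib_left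
    sum.distrib[symmetric] sum_subtractf[symmetric] mass_def[symmetric] stiff_def[symmetric]
  by (intro sum.cong refl) (simp add: algebra_simps)

lemma tensor_sum_add:
  "tensor_sum n c f g + tensor_sum n d f g = tensor_sum n (\<lambda>i j. c i j + d i j) f g"
  by (auto simp: fun_eq_iff tensor_sum_def sum.distrib distrib_right)

lemma cscale_tensor_sum: "cscale a (tensor_sum n c f g) = tensor_sum n (\<lambda>i j. a * c i j) f g"
  by (auto simp: fun_eq_iff cscale_def tensor_sum_def sum_distrib_left mult.assoc)

text \<open>
  The sums of products of basis polynomials form a subspace, and it contains the monomials
  \<open>x\<^sup>i y\<^sup>j\<close>: expand \<open>x\<^sup>i\<close> and \<open>y\<^sup>j\<close> in the basis, with coefficients \<open>A i\<close> and \<open>A j\<close>.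
\<close>

lemma Qpoly_tensor_sumE:
  assumes u: "u \<in> Qpoly (p - 1)" and p: "p > 0"
    and A: "\<And>i. i < p \<Longrightarrow> monom 1 i = (\<Sum>l<p. smult (A i l) (f l))"
  obtains c where "u = tensor_sum p c f f"
proof -
  let ?S = "range (\<lambda>c. tensor_sum p c f f)"
  have "cfun.subspace ?S"
  proof (rule cfun.subspaceI)
    have "0 = tensor_sum p (\<lambda>_ _. 0) f f" by (auto simp: tensor_sum_def fun_eq_iff)
    then show "0 \<in> ?S" by blast
  qed (auto simp: tensor_sum_add cscale_tensor_sum)
  moreover have "(\<lambda>(x, y). complex_of_real (x ^ i * y ^ j)) \<in> ?S" if "i \<le> p - 1" "j \<le> p - 1" for i j
  proof -
    have expand: "x ^ m = (\<Sum>l<p. A m l * poly (f l) x)" if "m \<le> p - 1" for m and x :: real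
    proof -
      have "x ^ m = poly (monom 1 m) x" by (simp add: poly_monom)
      also have "\<dots> = (\<Sum>l<p. A m l * poly (f l) x)"
        using that p by (subst A) (auto simp: poly_sum)
      finally show ?thesis .
    qed
    have "(\<lambda>(x, y). complex_of_real (x ^ i * y ^ j))
        = tensor_sum p (\<lambda>a b. of_real (A i a * A j b)) f f"
      by (auto simp: fun_eq_iff tensor_sum_def expand[OF that(1)] expand[OF that(2)]
          sum_product mult_ac simp flip: of_real_sum of_real_mult)
    then show ?thesis by blast
  qed
  ultimately have "Qpoly (p - 1) \<subseteq> ?S"
    unfolding Qpoly_def by (intro cfun.span_minimal) auto
  with u that show thesis by blast
qed

lemma Qpoly_monomialsE:
  assumes "u \<in> Qpoly (p - 1)" "p > 0"
  obtains c where "u = tensor_sum p c (monom 1) (monom 1)"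
proof -
  from Qpoly_tensor_sumE[OF assms monom_eq_sum_monom] that show thesis by blast
qed

lemma sum_apply: "(\<Sum>i\<in>A. F i) z = (\<Sum>i\<in>A. F i z)"
  by (induction A rule: infinite_finite_induct) auto

lemma tensor_sum_in_Qpoly:
  assumes "\<And>i. i < p \<Longrightarrow> degree (f i) < p"
  shows "tensor_sum p c f f \<in> Qpoly (p - 1)"
proof -
  let ?m = "\<lambda>a b (x, y). complex_of_real (x ^ a * y ^ b)"
  have "poly (f i) x = (\<Sum>a<p. coeff (f i) a * x ^ a)" if "i < p" for i x
    unfolding poly_altdef using assms[OF that]
    by (intro sum.mono_neutral_left) (auto simp: coeff_eq_0)
  then have "tensor_sum p c f f = (\<Sum>i<p. \<Sum>j<p. cscale (c i j)
      (\<Sum>a<p. \<Sum>b<p. cscale (of_real (coeff (f i) a * coeff (f j) b)) (?m a b)))"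
    by (auto simp: fun_eq_iff tensor_sum_def cscale_def sum_product sum_apply
        simp flip: of_real_sum of_real_mult intro!: sum.cong)
  also have "\<dots> \<in> Qpoly (p - 1)"
  proof -
    have "?m a b \<in> {(\<lambda>(x, y). of_real (x ^ i * y ^ j)) |i j. i \<le> p - 1 \<and> j \<le> p - 1}"
      if "a < p" "b < p" for a b
      unfolding mem_Collect_eq
      by (rule exI[of _ a], rule exI[of _ b]) (use that in auto)
    then show ?thesis
      unfolding Qpoly_def by (intro cfun.span_sum cfun.span_scale cfun.span_base) simp
  qed
  finally show ?thesis .
qed


section \<open>Polynomials vanishing on the square\<close>

text \<open>
  Vanishing on the square implies vanishing on the plane, so that all partial derivatives
  vanish as well, those at the boundary of the square included.  Fixing one variable at a time reduces this to the finiteness of the roots of a polynomial.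
\<close>

lemma Qpoly_zero_if_zero_on_Khat:
  assumes u: "u \<in> Qpoly (p - 1)" and p: "p > 0" and zero: "\<And>z. z \<in> Khat \<Longrightarrow> u z = 0"
  shows "u = (\<lambda>_. 0)"
proof -
  obtain c where c: "u = tensor_sum p c (monom 1) (monom 1)"
    using Qpoly_monomialsE[OF u p] .
  define P where "P y = (\<Sum>i<p. monom (\<Sum>j<p. c i j * of_real y ^ j) i)" for y :: real
  define R where "R x = (\<Sum>j<p. monom (\<Sum>i<p. c i j * of_real x ^ i) j)" for x :: real
  have P: "u (x, y) = poly (P y) (of_real x)" for x y
    by (simp add: c tensor_sum_def P_def poly_sum poly_monom sum_distrib_left sum_distrib_right mult_ac)
  have R: "u (x, y) = poly (R x) (of_real y)" for x y
    unfolding c tensor_sum_def R_def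
    by (subst sum.swap, simp add: poly_sum poly_monom sum_distrib_left sum_distrib_right mult_ac)
  have poly_zero: "Q = 0" if "\<And>x. x \<in> {-1..1} \<Longrightarrow> poly Q (of_real x) = 0" for Q :: "complex poly"
  proof (rule ccontr)
    assume "Q \<noteq> 0"
    then have "finite {x. poly Q x = 0}" by (rule poly_roots_finite)
    moreover have "complex_of_real ` {-1..1} \<subseteq> {x. poly Q x = 0}" using that by auto
    ultimately have "finite (complex_of_real ` {-1..1})" by (rule finite_subset[rotated])
    then have "finite {-1..1::real}"
      by (rule finite_imageD) (simp add: inj_on_def)
    then show False using infinite_Icc[of "-1::real" 1] by simp
  qed
  have "P y = 0" if "y \<in> {-1..1}" for y
    using that zero by (intro poly_zero) (auto simp: Khat_def simp flip: P)
  then have "u (x, y) = 0" if "y \<in> {-1..1}" for x y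
    using that by (simp add: P)
  then have "R x = 0" for x
    by (intro poly_zero) (simp flip: R)
  then show ?thesis by (auto simp: fun_eq_iff R)
qed

section \<open>Triviality from a biorthogonal pair of bases\<close>

text \<open>
  The real part of \<open>z i * cnj (z j)\<close> is symmetric in \<open>i\<close> and \<open>j\<close>, so only the symmetric part of
  \<open>K\<close> contributes, and that part is diagonal.
\<close>

lemma Re_skew_form_nonpos:
  fixes K :: "nat \<Rightarrow> nat \<Rightarrow> real" and z :: "nat \<Rightarrow> complex"
  assumes skew: "\<And>i j. i < n \<Longrightarrow> j < n \<Longrightarrow> i \<noteq> j \<Longrightarrow> K i j + K j i = 0"
    and diag: "\<And>i. i < n \<Longrightarrow> K i i \<le> 0"
  shows "Re (\<Sum>i<n. \<Sum>j<n. z i * cnj (z j) * of_real (K i j)) \<le> 0"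
proof -
  let ?S = "\<Sum>i<n. \<Sum>j<n. Re (z i * cnj (z j)) * K i j"
  have "?S = (\<Sum>i<n. \<Sum>j<n. Re (z i * cnj (z j)) * K j i)"
    by (subst sum.swap) (simp add: mult.commute)
  then have "2 * ?S = (\<Sum>i<n. \<Sum>j<n. Re (z i * cnj (z j)) * (K i j + K j i))"
    by (simp add: sum.distrib distrib_left del: times_complex.sel)
  also have "\<dots> \<le> 0"
  proof (intro sum_nonpos)
    fix i j assume ij: "i \<in> {..<n}" "j \<in> {..<n}"
    show "Re (z i * cnj (z j)) * (K i j + K j i) \<le> 0"
    proof (cases "i = j")
      case True
      then show ?thesis
        using diag[of i] ij by (intro mult_nonneg_nonpos) auto
    next
      case False
      then show ?thesis using skew[of i j] ij by simp
    qed
  qed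
  finally have "?S \<le> 0" by simp
  moreover have "Re (a * of_real r) = Re a * r" for a r by simp
  ultimately show ?thesis by (simp only: Re_sum)
qed

text \<open>
  The test function is the solution with its basis \<open>f\<close> replaced by \<open>g\<close>.  Biorthogonality removes
  one summation index from each term with \<open>stiff\<close>; what remains is a positive combination
  of quadratic forms as in \<open>Re_skew_form_nonpos\<close>, one for every row or column of the coefficients.
\<close>

lemma trivial_if_biorthogonal_skew:
  fixes f g :: "nat \<Rightarrow> real poly" and w :: "nat \<Rightarrow> real"
  assumes sol: "solves_problem p k u" and k: "k \<noteq> 0" and p: "p > 0"
    and basis: "\<And>i. i < p \<Longrightarrow> monom 1 i = (\<Sum>l<p. smult (A i l) (f l))"
    and deg: "\<And>i. i < p \<Longrightarrow> degree (g i) < p"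
    and mass: "\<And>i j. i < p \<Longrightarrow> j < p \<Longrightarrow> mass (f i) (g j) = (if j = i then w i else 0)"
    and w: "\<And>i. i < p \<Longrightarrow> w i > 0"
    and skew: "\<And>i j. i < p \<Longrightarrow> j < p \<Longrightarrow> i \<noteq> j \<Longrightarrow> stiff (f i) (g j) + stiff (f j) (g i) = 0"
    and diag: "\<And>i. i < p \<Longrightarrow> stiff (f i) (g i) \<le> 0"
  shows "u z = 0"
proof -
  let ?K = "\<lambda>i j. stiff (f i) (g j)" and ?M = "\<lambda>i j. mass (f i) (g j)"
  from sol have "u \<in> Qpoly (p - 1)" by (simp add: solves_problem_def)
  from Qpoly_tensor_sumE[OF this p basis] obtain c where u: "u = tensor_sum p c f f" by blast
  have "tensor_sum p c g g \<in> Qpoly (p - 1)"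
    by (rule tensor_sum_in_Qpoly) (rule deg)
  with sol have "(\<Sum>i<p. \<Sum>j<p. \<Sum>a<p. \<Sum>b<p. c i j * cnj (c a b) * of_real
        (?K i a * ?M j b + ?M i a * ?K j b - k ^ 2 * (?M i a * ?M j b))) = 0"
    unfolding solves_problem_def u weak_form_tensor_sum[symmetric] by blast
  also have "(\<Sum>i<p. \<Sum>j<p. \<Sum>a<p. \<Sum>b<p. c i j * cnj (c a b) * of_real
        (?K i a * ?M j b + ?M i a * ?K j b - k ^ 2 * (?M i a * ?M j b)))
      = (\<Sum>i<p. \<Sum>j<p. \<Sum>a<p. w j * (c i j * cnj (c a j) * of_real (?K i a)))
        + (\<Sum>i<p. \<Sum>j<p. \<Sum>b<p. w i * (c i j * cnj (c i b) * of_real (?K j b)))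
        - (\<Sum>i<p. \<Sum>j<p. k ^ 2 * w i * w j * (c i j * cnj (c i j)))"
  proof -
    have "(\<Sum>a<p. \<Sum>b<p. c i j * cnj (c a b) * of_real
        (?K i a * ?M j b + ?M i a * ?K j b - k ^ 2 * (?M i a * ?M j b)))
      = (\<Sum>a<p. w j * (c i j * cnj (c a j) * of_real (?K i a)))
        + (\<Sum>b<p. w i * (c i j * cnj (c i b) * of_real (?K j b)))
        - k ^ 2 * w i * w j * (c i j * cnj (c i j))" if ij: "i < p" "j < p" for i j
    proof -
      have K_M: "(\<Sum>a<p. \<Sum>b<p. c i j * cnj (c a b) * of_real (?K i a * ?M j b))
          = (\<Sum>a<p. w j * (c i j * cnj (c a j) * of_real (?K i a)))"
        by (rule sum.cong)
          (use ij in \<open>auto simp: mass if_distrib if_distribR mult_ac cong: if_cong sum.cong_simp\<close>)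
      have M_K: "(\<Sum>a<p. \<Sum>b<p. c i j * cnj (c a b) * of_real (?M i a * ?K j b))
          = (\<Sum>b<p. w i * (c i j * cnj (c i b) * of_real (?K j b)))"
        by (subst sum.swap, rule sum.cong)
          (use ij in \<open>auto simp: mass if_distrib if_distribR mult_ac cong: if_cong sum.cong_simp\<close>)
      have M_M: "(\<Sum>a<p. \<Sum>b<p. c i j * cnj (c a b) * of_real (k ^ 2 * (?M i a * ?M j b)))
          = k ^ 2 * w i * w j * (c i j * cnj (c i j))"
      proof -
        have "(\<Sum>a<p. \<Sum>b<p. c i j * cnj (c a b) * of_real (k ^ 2 * (?M i a * ?M j b)))
            = (\<Sum>a<p. if a = i then (\<Sum>b<p. if b = j
                then k ^ 2 * w i * w j * (c i j * cnj (c a b)) else 0) else 0)"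
          using ij by (intro sum.cong refl) (auto simp: mass if_distrib[of complex_of_real] mult_delta_right cong: if_cong)
        with ij show ?thesis by simp
      qed
      have split: "C * of_real (x + y - r) = C * of_real x + C * of_real y - C * of_real r"
        for C :: complex and x y r :: real
        by (simp add: algebra_simps)
      show ?thesis
        by (simp only: split sum.distrib sum_subtractf K_M M_K M_M)
    qed
    then have "(\<Sum>i<p. \<Sum>j<p. \<Sum>a<p. \<Sum>b<p. c i j * cnj (c a b) * of_real
        (?K i a * ?M j b + ?M i a * ?K j b - k ^ 2 * (?M i a * ?M j b)))
      = (\<Sum>i<p. \<Sum>j<p. (\<Sum>a<p. w j * (c i j * cnj (c a j) * of_real (?K i a)))
        + (\<Sum>b<p. w i * (c i j * cnj (c i b) * of_real (?K j b)))
        - k ^ 2 * w i * w j * (c i j * cnj (c i j)))"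
      by (intro sum.cong refl) simp_all
    then show ?thesis
      by (simp only: sum.distrib sum_subtractf)
  qed
  finally have eq: "(\<Sum>i<p. \<Sum>j<p. k ^ 2 * w i * w j * (c i j * cnj (c i j)))
      = (\<Sum>i<p. \<Sum>j<p. \<Sum>a<p. w j * (c i j * cnj (c a j) * of_real (?K i a)))
        + (\<Sum>i<p. \<Sum>j<p. \<Sum>b<p. w i * (c i j * cnj (c i b) * of_real (?K j b)))"
    by simp
  have "Re (\<Sum>i<p. \<Sum>j<p. \<Sum>a<p. w j * (c i j * cnj (c a j) * of_real (?K i a))) \<le> 0"
  proof -
    have "Re (\<Sum>i<p. \<Sum>j<p. \<Sum>a<p. w j * (c i j * cnj (c a j) * of_real (?K i a)))
        = (\<Sum>j<p. w j * Re (\<Sum>i<p. \<Sum>a<p. c i j * cnj (c a j) * of_real (?K i a)))"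
      by (subst sum.swap) (simp add: sum_distrib_left)
    also have "\<dots> \<le> 0"
      using w by (intro sum_nonpos mult_nonneg_nonpos Re_skew_form_nonpos skew diag) (auto intro: less_imp_le)
    finally show ?thesis .
  qed
  moreover have "Re (\<Sum>i<p. \<Sum>j<p. \<Sum>b<p. w i * (c i j * cnj (c i b) * of_real (?K j b))) \<le> 0"
  proof -
    have "Re (\<Sum>i<p. \<Sum>j<p. \<Sum>b<p. w i * (c i j * cnj (c i b) * of_real (?K j b)))
        = (\<Sum>i<p. w i * Re (\<Sum>j<p. \<Sum>b<p. c i j * cnj (c i b) * of_real (?K j b)))"
      by (simp add: sum_distrib_left)
    also have "\<dots> \<le> 0"
      using w by (intro sum_nonpos mult_nonneg_nonpos Re_skew_form_nonpos skew diag) (auto intro: less_imp_le)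
    finally show ?thesis .
  qed
  ultimately have "Re (\<Sum>i<p. \<Sum>j<p. k ^ 2 * w i * w j * (c i j * cnj (c i j))) \<le> 0"
    unfolding eq by simp
  also have "Re (\<Sum>i<p. \<Sum>j<p. k ^ 2 * w i * w j * (c i j * cnj (c i j)))
      = (\<Sum>i<p. \<Sum>j<p. k ^ 2 * w i * w j * (cmod (c i j))\<^sup>2)"
    by (simp flip: complex_norm_square of_real_mult of_real_power of_real_sum)
  finally have le: "(\<Sum>i<p. \<Sum>j<p. k ^ 2 * w i * w j * (cmod (c i j))\<^sup>2) \<le> 0" .
  have nonneg: "k ^ 2 * w i * w j * (cmod (c i j))\<^sup>2 \<ge> 0" if "i < p" "j < p" for i j
    using w[OF that(1)] w[OF that(2)] by simp
  have "c i j = 0" if ij: "i < p" "j < p" for i j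
  proof -
    have "k ^ 2 * w i * w j * (cmod (c i j))\<^sup>2
        \<le> (\<Sum>j<p. k ^ 2 * w i * w j * (cmod (c i j))\<^sup>2)"
      using ij nonneg by (intro member_le_sum) auto
    also have "\<dots> \<le> (\<Sum>i<p. \<Sum>j<p. k ^ 2 * w i * w j * (cmod (c i j))\<^sup>2)"
      using ij nonneg
      by (intro member_le_sum[of i _ "\<lambda>i. \<Sum>j<p. k ^ 2 * w i * w j * (cmod (c i j))\<^sup>2"] sum_nonneg) auto
    finally have "k ^ 2 * w i * w j * (cmod (c i j))\<^sup>2 = 0"
      using le nonneg[OF ij] by linarith
    then show ?thesis using k w[OF ij(1)] w[OF ij(2)] by simp
  qed
  then show ?thesis by (cases z) (simp add: u tensor_sum_def)
qed

text \<open>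
  The monomials \<open>1\<close> and \<open>x\<close> are orthogonal for \<open>mass\<close> by parity, and their stiffness matrix is
  already skew-symmetric off the diagonal, with diagonal \<open>-2, -2/3\<close>.
\<close>

lemma trivial_solution_p_le_2:
  assumes "solves_problem p k u" "k \<noteq> 0" "p \<in> {1, 2}"
  shows "u z = 0"
proof -
  let ?f = "\<lambda>i::nat. monom (1::real) i"
  let ?w = "\<lambda>i::nat. if i = 0 then 4 / 3 else 4 / 15 :: real"
  have lt: "i = 0 \<or> i = 1" if "i < p" for i using that assms(3) by auto
  show ?thesis
  proof (rule trivial_if_biorthogonal_skew[OF assms(1,2)])
    show "monom 1 i = (\<Sum>l<p. smult (if l = i then 1 else 0) (?f l))" if "i < p" for i
      using that by (rule monom_eq_sum_monom)
    show "mass (?f i) (?f j) = (if j = i then ?w i else 0)" if "i < p" "j < p" for i j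
      using lt[OF that(1)] lt[OF that(2)]
      by (auto simp: pairing_simps monom_0 monom_Suc)
    show "stiff (?f i) (?f j) + stiff (?f j) (?f i) = 0" if "i < p" "j < p" "i \<noteq> j" for i j
      using lt[OF that(1)] lt[OF that(2)] that(3)
      by (auto simp: pairing_simps monom_0 monom_Suc)
    show "stiff (?f i) (?f i) \<le> 0" if "i < p" for i
      using lt[OF that(1)]
      by (auto simp: pairing_simps monom_0 monom_Suc)
  qed (use assms(3) in \<open>auto simp: degree_monom_eq\<close>)
qed

text \<open>
  On quadratic polynomials the symmetric part of \<open>stiff\<close> is indefinite (it is negative at \<open>1\<close> and
  positive at \<open>1 - x\<^sup>2\<close>), so no basis can serve as its own test family.  Starting from \<open>(1 + x)\<^sup>2\<close>, the operator \<open>B\<close> of the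
  introduction takes the Schwarz form in the basis \<open>?f\<close>: the matrix of \<open>stiff\<close> is tridiagonal with
  diagonal \<open>0, 0, -96\<close> and off-diagonal entries \<open>\<plusminus>128\<close> and \<open>\<plusminus>64\<close>.  The family \<open>?g\<close> is the
  basis dual to \<open>?f\<close> for \<open>mass\<close>, scaled so that these entries are opposite in pairs.
\<close>

lemma trivial_solution_p_3:
  assumes "solves_problem 3 k u" "k \<noteq> 0"
  shows "u z = 0"
proof -
  let ?f = "\<lambda>i::nat. [[:1, 2, 1:], [:1:], [:1, 2, 7:]] ! i :: real poly"
  let ?g = "\<lambda>i::nat. [[:8, 32, -40:], [:30, -40, -70:], [:-7, -4, 35:]] ! i :: real poly"
  let ?w = "\<lambda>i::nat. [512 / 35, 64 / 3, 64 / 5] ! i :: real"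
  \<comment> \<open>\<open>x\<close> and \<open>x\<^sup>2\<close> in the basis: \<open>6 x\<^sup>2 = f\<^sub>2 - f\<^sub>0\<close> and \<open>2 x = f\<^sub>0 - f\<^sub>1 - x\<^sup>2\<close>\<close>
  let ?A = "\<lambda>i l. [[0, 1, 0], [7 / 12, - (1 / 2), - (1 / 12)], [- (1 / 6), 0, 1 / 6]] ! i ! l :: real"
  show ?thesis
  proof (rule trivial_if_biorthogonal_skew[OF assms])
    show "monom 1 i = (\<Sum>l<3. smult (?A i l) (?f l))" if "i < 3" for i
      using that
      by (auto simp: less_3_cases monom_0 monom_Suc monom_2 lessThan_nat_numeral)
    show "degree (?g i) < 3" if "i < 3" for i
      using that by (auto simp: less_3_cases)
    show "mass (?f i) (?g j) = (if j = i then ?w i else 0)" if "i < 3" "j < 3" for i j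
      using that by (auto simp: less_3_cases pairing_simps)
    show "stiff (?f i) (?g j) + stiff (?f j) (?g i) = 0" if "i < 3" "j < 3" "i \<noteq> j" for i j
      using that by (auto simp: less_3_cases pairing_simps)
    show "stiff (?f i) (?g i) \<le> 0" "?w i > 0" if "i < 3" for i
      using that by (auto simp: less_3_cases pairing_simps)
  qed simp
qed


section \<open>A product solution for \<open>p = 4\<close>\<close>

text \<open>
  With \<open>V\<close> and \<open>V'\<close> the univariate eigenvectors, the form tested with \<open>x\<^sup>a y\<^sup>b\<close> is
  \<open>(l + m - k\<^sup>2) M(V, x\<^sup>a) M(V', y\<^sup>b)\<close>.
\<close>

lemma solves_problem_tensor_eigen:
  fixes v v' :: "nat \<Rightarrow> complex" and f :: "nat \<Rightarrow> real poly"
  assumes p: "p > 0" and deg: "\<And>i. i < p \<Longrightarrow> degree (f i) < p"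
    and v: "\<And>a. a < p \<Longrightarrow> (\<Sum>i<p. v i * of_real (stiff (f i) (monom 1 a)))
        = l * (\<Sum>i<p. v i * of_real (mass (f i) (monom 1 a)))"
    and v': "\<And>a. a < p \<Longrightarrow> (\<Sum>i<p. v' i * of_real (stiff (f i) (monom 1 a)))
        = m * (\<Sum>i<p. v' i * of_real (mass (f i) (monom 1 a)))"
    and sum: "l + m = of_real (k ^ 2)"
  shows "solves_problem p k (tensor_sum p (\<lambda>i j. v i * v' j) f f)"
  unfolding solves_problem_def
proof (intro conjI ballI)
  show "tensor_sum p (\<lambda>i j. v i * v' j) f f \<in> Qpoly (p - 1)"
    by (rule tensor_sum_in_Qpoly) (rule deg)
next
  fix t assume "t \<in> Qpoly (p - 1)"
  from Qpoly_monomialsE[OF this p] obtain d where t: "t = tensor_sum p d (monom 1) (monom 1)"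
    by blast
  let ?K = "\<lambda>i a. of_real (stiff (f i) (monom 1 a)) :: complex"
  let ?M = "\<lambda>i a. of_real (mass (f i) (monom 1 a)) :: complex"
  let ?KM = "\<lambda>i j a b. ?K i a * ?M j b + ?M i a * ?K j b - of_real (k ^ 2) * (?M i a * ?M j b)"
  have "(\<Sum>i<p. \<Sum>j<p. \<Sum>a<p. \<Sum>b<p. v i * v' j * cnj (d a b) * ?KM i j a b)
      = (\<Sum>i<p. \<Sum>a<p. \<Sum>b<p. \<Sum>j<p. v i * v' j * cnj (d a b) * ?KM i j a b)"
    by (rule sum.cong[OF refl], subst sum.swap, rule sum.cong[OF refl], rule sum.swap)
  also have "\<dots> = (\<Sum>a<p. \<Sum>b<p. \<Sum>i<p. \<Sum>j<p. v i * v' j * cnj (d a b) * ?KM i j a b)"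
    by (subst sum.swap, rule sum.cong[OF refl], rule sum.swap)
  also have "\<dots> = 0"
  proof (rule sum.neutral[OF ballI], rule sum.neutral[OF ballI])
    fix a b assume ab: "a \<in> {..<p}" "b \<in> {..<p}"
    have "(\<Sum>i<p. \<Sum>j<p. v i * v' j * cnj (d a b) * ?KM i j a b)
      = (\<Sum>i<p. \<Sum>j<p. cnj (d a b) * ((v i * ?K i a) * (v' j * ?M j b))
          + cnj (d a b) * ((v i * ?M i a) * (v' j * ?K j b))
          - cnj (d a b) * (of_real (k ^ 2) * ((v i * ?M i a) * (v' j * ?M j b))))"
      by (intro sum.cong refl) (simp only: ring_distribs mult_ac)
    also have "\<dots> = cnj (d a b) * ((\<Sum>i<p. v i * ?K i a) * (\<Sum>j<p. v' j * ?M j b))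
          + cnj (d a b) * ((\<Sum>i<p. v i * ?M i a) * (\<Sum>j<p. v' j * ?K j b))
          - cnj (d a b) * (of_real (k ^ 2) * ((\<Sum>i<p. v i * ?M i a) * (\<Sum>j<p. v' j * ?M j b)))"
      unfolding sum_product sum.distrib sum_subtractf
      unfolding sum_distrib_left ..
    also have "\<dots> = cnj (d a b) * (l + m - of_real (k ^ 2))
          * ((\<Sum>i<p. v i * ?M i a) * (\<Sum>j<p. v' j * ?M j b))"
      using ab by (simp add: v v' algebra_simps del: of_real_power)
    also have "\<dots> = 0" by (simp add: sum)
    finally show "(\<Sum>i<p. \<Sum>j<p. v i * v' j * cnj (d a b) * ?KM i j a b) = 0" .
  qed
  finally show "grad_ip (\<lambda>z. b_in z * tensor_sum p (\<lambda>i j. v i * v' j) f f z) (\<lambda>z. b_out z * t z)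
      - of_real (k ^ 2) * L2_ip (\<lambda>z. b_in z * tensor_sum p (\<lambda>i j. v i * v' j) f f z) (\<lambda>z. b_out z * t z) = 0"
    unfolding t weak_form_tensor_sum of_real_add of_real_diff of_real_mult .
qed

text \<open>
  The characteristic polynomial of the operator \<open>B\<close> of the introduction for \<open>p = 4\<close>.
\<close>

definition quartic4 :: "complex \<Rightarrow> complex"
  where "quartic4 t = t ^ 4 + 12 * t ^ 3 + 189 * t ^ 2 + 2520 * t + 19845"

text \<open>
  Horner's scheme for the characteristic polynomial
  \<open>t\<^sup>4 + c\<^sub>1 t\<^sup>3 + c\<^sub>2 t\<^sup>2 + c\<^sub>3 t + c\<^sub>4\<close>: with \<open>h\<^sub>0 = (1 + x)\<^sup>3\<close> and
  \<open>h\<^sub>i = B h\<^sub>i\<^sub>-\<^sub>1 + c\<^sub>i h\<^sub>0\<close>, the Cayley-Hamilton theorem gives \<open>B h\<^sub>3 + c\<^sub>4 h\<^sub>0 = 0\<close>, and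
  \<open>t\<^sup>3 h\<^sub>0 + t\<^sup>2 h\<^sub>1 + t h\<^sub>2 + h\<^sub>3\<close> is an eigenvector for every root \<open>t\<close>.  The choice of \<open>h\<^sub>0\<close>
  keeps the coefficients small.
\<close>

definition horner4 :: "nat \<Rightarrow> real poly"
  where "horner4 i =
    [[:1, 3, 3, 1:], [:0, 24, 36, 12:], [:60, 444, 672:], [:693, 1575, 7875, 11025:]] ! i"

lemma stiff_horner4:
  assumes "a < 4"
  shows "stiff (horner4 0) (monom 1 a) = mass (horner4 1) (monom 1 a) - 12 * mass (horner4 0) (monom 1 a)"
    and "stiff (horner4 1) (monom 1 a) = mass (horner4 2) (monom 1 a) - 189 * mass (horner4 0) (monom 1 a)"
    and "stiff (horner4 2) (monom 1 a) = mass (horner4 3) (monom 1 a) - 2520 * mass (horner4 0) (monom 1 a)"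
    and "stiff (horner4 3) (monom 1 a) = - 19845 * mass (horner4 0) (monom 1 a)"
  using assms
  by (auto simp: less_4_cases horner4_def pairing_simps monom_0 monom_Suc monom_2 monom_3)

text \<open>
  The sums telescope; the remainder is a multiple of \<open>quartic4 t\<close>.
\<close>

lemma horner4_eigen:
  assumes "quartic4 t = 0" "a < 4"
  shows "(\<Sum>i<4. t ^ (3 - i) * of_real (stiff (horner4 i) (monom 1 a)))
       = t * (\<Sum>i<4. t ^ (3 - i) * of_real (mass (horner4 i) (monom 1 a)))"
proof -
  have sum4: "(\<Sum>i<4. F i) = F 0 + F 1 + F 2 + F 3" for F :: "nat \<Rightarrow> complex"
    by (simp add: eval_nat_numeral)
  have "t * (\<Sum>i<4. t ^ (3 - i) * of_real (mass (horner4 i) (monom 1 a)))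
      - (\<Sum>i<4. t ^ (3 - i) * of_real (stiff (horner4 i) (monom 1 a)))
      = quartic4 t * of_real (mass (horner4 0) (monom 1 a))"
    unfolding sum4 stiff_horner4[OF assms(2)] quartic4_def
    by (simp add: algebra_simps power2_eq_square power3_eq_cube power4_eq_xxxx)
  with assms(1) show ?thesis by simp
qed

text \<open>
  A pair of roots with sum \<open>s\<close> corresponds to a factorisation
  \<open>(t\<^sup>2 - s t + r) (t\<^sup>2 + (12 + s) t + q)\<close>.  The coefficients of \<open>t\<^sup>2\<close> and \<open>t\<close> determine \<open>r\<close>
  and \<open>q\<close> as rational functions of \<open>s\<close>, and the condition \<open>r q = 19845\<close> on the constant term
  is met for some \<open>s\<close> between \<open>11/2\<close> and \<open>6\<close> by the intermediate value theorem.
\<close>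

lemma quartic4_roots_positive_sum:
  obtains s :: real and t t' :: complex
  where "s > 0" "quartic4 t = 0" "quartic4 t' = 0" "t + t' = of_real s"
proof -
  define A where "A s = 189 + s * (12 + s)" for s :: real
  define r where "r s = (2520 + s * A s) / (12 + 2 * s)" for s
  have "\<exists>s\<ge>11 / 2. s \<le> 6 \<and> r s * (A s - r s) = 19845"
  proof (rule IVT')
    show "continuous_on {11 / 2..6} (\<lambda>s. r s * (A s - r s))"
      unfolding r_def A_def by (intro continuous_intros) auto
  qed (simp_all add: r_def A_def)
  then obtain s where s: "s \<ge> 11 / 2" "r s * (A s - r s) = 19845" by blast
  define q where "q = A s - r s"
  have rq: "r s * q = 19845" using s by (simp add: q_def)
  have sum: "q + r s = 189 + s * (12 + s)" by (simp add: q_def A_def)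
  have lin: "r s * (12 + s) - s * q = 2520"
  proof -
    have "r s * (12 + 2 * s) = 2520 + s * A s" using s by (simp add: r_def)
    then show ?thesis by (simp add: q_def algebra_simps)
  qed
  have factor: "quartic4 t = (t ^ 2 - of_real s * t + of_real (r s)) * (t ^ 2 + (12 + of_real s) * t + of_real q)" for t
  proof -
    have "(t ^ 2 - of_real s * t + of_real (r s)) * (t ^ 2 + (12 + of_real s) * t + of_real q)
        = t ^ 4 + 12 * t ^ 3 + of_real (q + r s - s * (12 + s)) * t ^ 2
          + of_real (r s * (12 + s) - s * q) * t + of_real (r s * q)"
      by (simp add: algebra_simps power2_eq_square power3_eq_cube power4_eq_xxxx)
    then show ?thesis by (simp only: rq sum lin quartic4_def) simp
  qed
  define D where "D = csqrt (of_real (s ^ 2 - 4 * r s))"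
  have D: "D ^ 2 = of_real (s ^ 2 - 4 * r s)" by (simp add: D_def)
  have root: "quartic4 ((of_real s + e) / 2) = 0" if "e ^ 2 = of_real (s ^ 2 - 4 * r s)" for e
  proof -
    have "((of_real s + e) / 2) ^ 2 - of_real s * ((of_real s + e) / 2) + of_real (r s)
        = (e ^ 2 - of_real (s ^ 2 - 4 * r s)) / 4"
      by (simp add: field_simps power2_eq_square)
    with that show ?thesis by (simp add: factor)
  qed
  show thesis
  proof (rule that)
    show "s > 0" using s by simp
    show "quartic4 ((of_real s + D) / 2) = 0" "quartic4 ((of_real s + - D) / 2) = 0"
      by (rule root; simp add: D)+
    show "(of_real s + D) / 2 + (of_real s + - D) / 2 = of_real s" by (simp add: field_simps)
  qed
qed

lemma nontrivial_solution_p_4: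
  "\<exists>k::real. k > 0 \<and> (\<exists>u. solves_problem 4 k u \<and> (\<exists>z \<in> Khat. u z \<noteq> 0))"
proof -
  obtain s :: real and t t' :: complex
    where s: "s > 0" and roots: "quartic4 t = 0" "quartic4 t' = 0" and sum: "t + t' = of_real s"
    by (rule quartic4_roots_positive_sum)
  let ?u = "tensor_sum 4 (\<lambda>i j. t ^ (3 - i) * t' ^ (3 - j)) horner4 horner4"
  have "solves_problem 4 (sqrt s) ?u"
  proof (rule solves_problem_tensor_eigen[where v = "\<lambda>i. t ^ (3 - i)" and v' = "\<lambda>i. t' ^ (3 - i)"])
    show "degree (horner4 i) < 4" if "i < 4" for i
      using that by (auto simp: less_4_cases horner4_def)
    show "t + t' = of_real (sqrt s ^ 2)" using sum s by simp
  qed (use horner4_eigen roots in auto)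
  \<comment> \<open>at \<open>-1\<close> the first two Horner polynomials vanish, and the eigenvector for \<open>t\<close> has the value
    \<open>288 t - 4032\<close>, whose zero \<open>14\<close> is not a root of the quartic\<close>
  moreover have "?u (-1, -1) \<noteq> 0"
  proof -
    have "?u (-1, -1) = (\<Sum>i<4. t ^ (3 - i) * of_real (poly (horner4 i) (-1)))
        * (\<Sum>j<4. t' ^ (3 - j) * of_real (poly (horner4 j) (-1)))"
      unfolding tensor_sum_def sum_product by (auto intro!: sum.cong)
    also have "\<dots> = (288 * (t - 14)) * (288 * (t' - 14))"
      by (simp add: lessThan_nat_numeral horner4_def algebra_simps)
    moreover have "t \<noteq> 14" "t' \<noteq> 14" using roots by (auto simp: quartic4_def)
    ultimately show ?thesis by simp
  qed
  moreover have "(-1, -1) \<in> Khat" by (simp add: Khat_def)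
  ultimately show ?thesis using s by (intro exI[of _ "sqrt s"]) auto
qed

section \<open>Uniqueness for \<open>p \<le> 3\<close> and its failure for \<open>p = 4\<close>\<close>

theorem lemma3p11:
  shows "(\<forall>p \<in> {1, 2, 3}. \<forall>k::real. k \<noteq> 0 \<longrightarrow>
           (\<forall>u. solves_problem p k u \<longleftrightarrow> u \<in> Qpoly (p - 1) \<and> (\<forall>z \<in> Khat. u z = 0))) \<and>
         (\<exists>k::real. k > 0 \<and> (\<exists>u. solves_problem 4 k u \<and> (\<exists>z \<in> Khat. u z \<noteq> 0)))"
proof (intro conjI ballI allI impI nontrivial_solution_p_4 iffI)
  fix p :: nat and k :: real and u
  assume p: "p \<in> {1, 2, 3}" and k: "k \<noteq> 0"
  { assume sol: "solves_problem p k u"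
    then show "u \<in> Qpoly (p - 1)" by (simp add: solves_problem_def)
    show "u z = 0" for z
      using trivial_solution_p_le_2[of p k u z] trivial_solution_p_3[of k u z] sol p k by auto }
  assume u: "u \<in> Qpoly (p - 1) \<and> (\<forall>z \<in> Khat. u z = 0)"
  then have "u = (\<lambda>_. 0)" using p by (intro Qpoly_zero_if_zero_on_Khat[of u p]) auto
  with u show "solves_problem p k u"
    by (simp add: solves_problem_def grad_ip_def L2_ip_def partial_x_def partial_y_def
        case_prod_beta set_lebesgue_integral_def)
qed

end
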